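(* Let $\{e_1,\dots,e_n\}$ be a complete set of orthogonal idempotents of a ring $R$, and let $X=\mathcal{D}(R^\pi)^-$. (1) If $\{e_1,\dots,e_n\}\subseteq\mathfrak{P}_{\rm it}(R)$, then $X^n=0$ and $\bigoplus_{i=1}^nR_i$ is a homomorphic image of $R^\pi$ with kernel $X$, where $R_i=e_iRe_i$. (2) If $\{e_1,\dots,e_n\}\subseteq\mathfrak{P}_{\rm t}(R)$, then $X^2=0$.
   Context: All rings are associative with unity. A complete set of orthogonal idempotents is a set of pairwise orthogonal idempotents with sum $1$. $R^\pi$ is the $n$-by-$n$ array with $(i,j)$-position $e_iRe_j$, a ring under componentwise addition and row-column multiplication (using the multiplication of $R$). $\mathcal{D}(R^\pi)^-=\{[r_{ij}]\in R^\pi\mid r_{ii}=0\text{ for all } i\}$. For an idempotent $e\in R$: $e$ is inner Peirce trivial if $eR(1-e)Re=0$; outer Peirce trivial if $(1-e)ReR(1-e)=0$; Peirce trivial if both. $\mathfrak{P}_{\rm it}(R)$ and $\mathfrak{P}_{\rm t}(R)$ denote the sets of inner Peirce trivial and of Peirce trivial idempotents of $R$. *)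

theory Defs
  imports "HOL-Algebra.Ideal_Product" "HOL-Algebra.Chinese_Remainder"
begin

text \<open>
  Products of subsets of a ring are taken with \<^const>\<open>ideal_prod\<close>: the finite nonempty sums of
  products of elements. For nonempty factors at least one of which is an additive subgroup this is
  the usual product of subsets in noncommutative ring theory, so that e.g. \<open>e R (1 - e) R e\<close>
  below consists of all finite sums of elements \<open>e r (1 - e) s e\<close>.
\<close>

definition complete_orthogonal_idempotents ::
  "('a, 'm) ring_scheme \<Rightarrow> (nat \<Rightarrow> 'a) \<Rightarrow> nat \<Rightarrow> bool"
  where "complete_orthogonal_idempotents R e n \<longleftrightarrow>
    (\<forall>i\<in>{1..n}. e i \<in> carrier R \<and> e i \<otimes>\<^bsub>R\<^esub> e i = e i) \<and>
    (\<forall>i\<in>{1..n}. \<forall>j\<in>{1..n}. i \<noteq> j \<longrightarrow> e i \<otimes>\<^bsub>R\<^esub> e j = \<zero>\<^bsub>R\<^esub>) \<and>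
    (\<Oplus>\<^bsub>R\<^esub>i\<in>{1..n}. e i) = \<one>\<^bsub>R\<^esub>"

definition inner_Peirce_trivial :: "('a, 'm) ring_scheme \<Rightarrow> 'a \<Rightarrow> bool"
  where "inner_Peirce_trivial R e \<longleftrightarrow>
    {e} \<cdot>\<^bsub>R\<^esub> carrier R \<cdot>\<^bsub>R\<^esub> {\<one>\<^bsub>R\<^esub> \<ominus>\<^bsub>R\<^esub> e} \<cdot>\<^bsub>R\<^esub> carrier R \<cdot>\<^bsub>R\<^esub> {e} = {\<zero>\<^bsub>R\<^esub>}"

definition outer_Peirce_trivial :: "('a, 'm) ring_scheme \<Rightarrow> 'a \<Rightarrow> bool"
  where "outer_Peirce_trivial R e \<longleftrightarrow>
    {\<one>\<^bsub>R\<^esub> \<ominus>\<^bsub>R\<^esub> e} \<cdot>\<^bsub>R\<^esub> carrier R \<cdot>\<^bsub>R\<^esub> {e} \<cdot>\<^bsub>R\<^esub> carrier R \<cdot>\<^bsub>R\<^esub> {\<one>\<^bsub>R\<^esub> \<ominus>\<^bsub>R\<^esub> e} = {\<zero>\<^bsub>R\<^esub>}"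

definition inner_Peirce_trivial_idempotents :: "('a, 'm) ring_scheme \<Rightarrow> 'a set"
  where "inner_Peirce_trivial_idempotents R =
    {e \<in> carrier R. e \<otimes>\<^bsub>R\<^esub> e = e \<and> inner_Peirce_trivial R e}"

definition Peirce_trivial_idempotents :: "('a, 'm) ring_scheme \<Rightarrow> 'a set"
  where "Peirce_trivial_idempotents R =
    {e \<in> carrier R. e \<otimes>\<^bsub>R\<^esub> e = e \<and> inner_Peirce_trivial R e \<and> outer_Peirce_trivial R e}"

definition Peirce_component :: "('a, 'm) ring_scheme \<Rightarrow> 'a \<Rightarrow> 'a \<Rightarrow> 'a set"
  where "Peirce_component R e f = {e \<otimes>\<^bsub>R\<^esub> r \<otimes>\<^bsub>R\<^esub> f | r. r \<in> carrier R}"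

text \<open>The ring \<open>e R e\<close>, with identity \<open>e\<close>.\<close>

definition corner_ring :: "('a, 'm) ring_scheme \<Rightarrow> 'a \<Rightarrow> ('a, 'm) ring_scheme"
  where "corner_ring R e = R\<lparr>carrier := Peirce_component R e e, one := e\<rparr>"

text \<open>An \<open>n\<close>-by-\<open>n\<close> array is a function on pairs of indices in \<open>{1..n}\<close>, extensional (i.e.
  \<^const>\<open>undefined\<close>) outside \<open>{1..n} \<times> {1..n}\<close>.\<close>

definition Peirce_ring ::
  "('a, 'm) ring_scheme \<Rightarrow> (nat \<Rightarrow> 'a) \<Rightarrow> nat \<Rightarrow> (nat \<times> nat \<Rightarrow> 'a) ring"
  where "Peirce_ring R e n = \<lparr>
    carrier = (\<Pi>\<^sub>E (i, j)\<in>{1..n} \<times> {1..n}. Peirce_component R (e i) (e j)),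
    mult = (\<lambda>A B. \<lambda>(i, j)\<in>{1..n} \<times> {1..n}. \<Oplus>\<^bsub>R\<^esub>k\<in>{1..n}. A (i, k) \<otimes>\<^bsub>R\<^esub> B (k, j)),
    one = (\<lambda>(i, j)\<in>{1..n} \<times> {1..n}. if i = j then e i else \<zero>\<^bsub>R\<^esub>),
    zero = (\<lambda>(i, j)\<in>{1..n} \<times> {1..n}. \<zero>\<^bsub>R\<^esub>),
    add = (\<lambda>A B. \<lambda>(i, j)\<in>{1..n} \<times> {1..n}. A (i, j) \<oplus>\<^bsub>R\<^esub> B (i, j)) \<rparr>"

text \<open>The set \<open>\<D>(R\<^sup>\<pi>)\<^sup>-\<close>.\<close>

definition zero_diagonal ::
  "('a, 'm) ring_scheme \<Rightarrow> (nat \<Rightarrow> 'a) \<Rightarrow> nat \<Rightarrow> (nat \<times> nat \<Rightarrow> 'a) set"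
  where "zero_diagonal R e n =
    {A \<in> carrier (Peirce_ring R e n). \<forall>i\<in>{1..n}. A (i, i) = \<zero>\<^bsub>R\<^esub>}"

text \<open>The power \<open>X\<^sup>k\<close> of a subset. The first power is \<open>X\<close> itself, also when \<open>X\<close> is not an ideal.\<close>

fun subset_power :: "('a, 'm) ring_scheme \<Rightarrow> 'a set \<Rightarrow> nat \<Rightarrow> 'a set"
  where
    "subset_power R X 0 = carrier R"
  | "subset_power R X (Suc 0) = X"
  | "subset_power R X (Suc (Suc k)) = subset_power R X (Suc k) \<cdot>\<^bsub>R\<^esub> X"

end

theory Submission
  imports Defs
begin

text \<open>
  Inner Peirce triviality of \<open>e\<^sub>i\<close> says that \<open>e\<^sub>i R e\<^sub>j R e\<^sub>i = 0\<close> for all \<open>j \<noteq> i\<close>, because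
  \<open>e\<^sub>j = (1 - e\<^sub>i) e\<^sub>j\<close>. Read an entry of a product of arrays as a sum over paths through the index
  set: a path that leaves \<open>i\<close> and later comes back to \<open>i\<close> contributes zero. Both claims of part
  (1) come from this.

  For the homomorphism, the \<open>(i, i)\<close>-entry of \<open>A B\<close> reduces to the one path that stays at \<open>i\<close>, so
  that taking the diagonal is multiplicative (\<open>diagonal_hom\<close>); its kernel is \<open>X\<close> by definition,
  and diagonal arrays show that it is onto. That \<open>R\<^sup>\<pi>\<close> is a ring at all is read off from the
  Peirce decomposition \<open>r \<mapsto> [e\<^sub>i r e\<^sub>j]\<close>, a bijection from \<open>R\<close> that respects the operations.

  For \<open>X\<^sup>n = 0\<close>, a path that contributes to a product of elements of \<open>X\<close> never stays at an index,
  since diagonals vanish, and never returns to one; a path with \<open>n\<close> steps visits \<open>n + 1\<close> indices,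
  and there are only \<open>n\<close>. Instead of expanding products into sums over paths, the proof follows
  the tail \<open>v\<close> of a path, i.e. the part already multiplied on the right: the set \<open>S\<close> of indices
  which it has used up is recorded by \<open>e\<^sub>s R v = 0\<close> for \<open>s \<in> S\<close>. Each further factor from \<open>X\<close>
  enlarges \<open>S\<close> by one (\<open>zero_diagonal_power_annihilates\<close>).

  For part (2), outer Peirce triviality of \<open>e\<^sub>k\<close> says that \<open>e\<^sub>i R e\<^sub>k R e\<^sub>j = 0\<close> whenever
  \<open>k\<close> differs from \<open>i\<close> and \<open>j\<close>, and the terms with \<open>k = i\<close> or \<open>k = j\<close> in an entry of a product of
  two elements of \<open>X\<close> contain a diagonal entry.
\<close>

section \<open>Peirce components and corner rings\<close>

lemma (in ring) mem_Peirce_component_iff: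
  assumes "e \<in> carrier R" "f \<in> carrier R" "e \<otimes> e = e" "f \<otimes> f = f"
  shows "x \<in> Peirce_component R e f \<longleftrightarrow> x \<in> carrier R \<and> e \<otimes> x = x \<and> x \<otimes> f = x"
proof
  assume "x \<in> Peirce_component R e f"
  then obtain r where r: "r \<in> carrier R" "x = e \<otimes> r \<otimes> f"
    by (auto simp: Peirce_component_def)
  have "e \<otimes> x = (e \<otimes> e) \<otimes> r \<otimes> f" "x \<otimes> f = e \<otimes> r \<otimes> (f \<otimes> f)"
    using r assms(1,2) by (simp_all only: m_assoc m_closed)
  then show "x \<in> carrier R \<and> e \<otimes> x = x \<and> x \<otimes> f = x"
    using r assms by simp
next
  assume "x \<in> carrier R \<and> e \<otimes> x = x \<and> x \<otimes> f = x"
  then have "x = e \<otimes> x \<otimes> f" "x \<in> carrier R" by simp_all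
  then show "x \<in> Peirce_component R e f"
    unfolding Peirce_component_def by blast
qed

lemma (in ring) corner_ring_is_ring:
  assumes e: "e \<in> carrier R" "e \<otimes> e = e"
  shows "ring (corner_ring R e)"
proof -
  note mem = mem_Peirce_component_iff[OF e(1) e(1) e(2) e(2)]
  have inv: "\<ominus> x \<in> Peirce_component R e e" if "x \<in> Peirce_component R e e" for x
    using that e by (simp add: mem r_minus l_minus)
  show ?thesis
  proof (rule ringI)
    show "abelian_group (corner_ring R e)"
    proof (rule abelian_groupI)
      fix x assume "x \<in> carrier (corner_ring R e)"
      then show "\<exists>y\<in>carrier (corner_ring R e). y \<oplus>\<^bsub>corner_ring R e\<^esub> x = \<zero>\<^bsub>corner_ring R e\<^esub>"
        using e inv by (intro bexI[of _ "\<ominus> x"]) (auto simp: corner_ring_def mem l_neg)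
    qed (use e in \<open>auto simp: corner_ring_def mem a_ac l_distr r_distr\<close>)
    show "monoid (corner_ring R e)"
    proof (rule monoidI)
      fix x y
      assume xy: "x \<in> carrier (corner_ring R e)" "y \<in> carrier (corner_ring R e)"
      then have "e \<otimes> (x \<otimes> y) = x \<otimes> y"
        using m_assoc[of e x y] e by (simp add: corner_ring_def mem)
      then show "x \<otimes>\<^bsub>corner_ring R e\<^esub> y \<in> carrier (corner_ring R e)"
        using xy e by (simp add: corner_ring_def mem m_assoc)
    qed (use e in \<open>auto simp: corner_ring_def mem m_assoc\<close>)
  qed (auto simp: corner_ring_def mem l_distr r_distr)
qed

section \<open>Homomorphisms into direct products of rings\<close>

text \<open>The universal property of the direct product, used for the diagonal.\<close>

lemma ring_hom_RDirProd_list: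
  assumes "\<And>i. i \<in> set is \<Longrightarrow> f i \<in> ring_hom A (S i)"
  shows "(\<lambda>a. map (\<lambda>i. f i a) is) \<in> ring_hom A (RDirProd_list (map S is))"
  using assms
proof (induction "is")
  case Nil
  then show ?case by (auto simp: ring_hom_def monoid.defs)
next
  case (Cons i js)
  have "(\<lambda>(r, s). (f i r, map (\<lambda>i. f i s) js))
      \<in> ring_hom (RDirProd A A) (RDirProd (S i) (RDirProd_list (map S js)))"
    using Cons by (intro RDirProd_hom3) auto
  from ring_hom_trans[OF ring_hom_trans[OF RDirProd_hom1 this] RDirProd_list_hom1]
  show ?case by (simp add: comp_def)
qed

lemma zero_RDirProd_list_map:
  "\<zero>\<^bsub>RDirProd_list (map S is)\<^esub> = map (\<lambda>i. \<zero>\<^bsub>S i\<^esub>) is"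
  by (induction "is") (simp_all add: RDirProd_list_zero monoid.defs)

lemma (in abelian_monoid) finsum_eq_single_term:
  assumes "finite A" "i \<in> A" "f i \<in> carrier G" "\<And>j. j \<in> A \<Longrightarrow> j \<noteq> i \<Longrightarrow> f j = \<zero>"
  shows "(\<Oplus>j\<in>A. f j) = f i"
proof -
  have "(\<Oplus>j\<in>A. f j) = (\<Oplus>j\<in>{i}. f j)"
    using assms by (intro add.finprod_mono_neutral_cong_right) (auto, metis zero_closed)
  also have "\<dots> = f i" using assms by simp
  finally show ?thesis .
qed

section \<open>The ring of Peirce arrays\<close>

locale complete_idempotents = ring R for R (structure) +
  fixes e :: "nat \<Rightarrow> 'a" and n :: nat
  assumes complete: "complete_orthogonal_idempotents R e n"
begin

abbreviation P where "P \<equiv> Peirce_ring R e n"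

lemma idem_closed [simp]: "i \<in> {1..n} \<Longrightarrow> e i \<in> carrier R"
  and idem [simp]: "i \<in> {1..n} \<Longrightarrow> e i \<otimes> e i = e i"
  and orthogonal: "i \<in> {1..n} \<Longrightarrow> j \<in> {1..n} \<Longrightarrow> i \<noteq> j \<Longrightarrow> e i \<otimes> e j = \<zero>"
  and sum_idem: "(\<Oplus>i\<in>{1..n}. e i) = \<one>"
  using complete unfolding complete_orthogonal_idempotents_def by auto

lemma mem_component_iff:
  assumes "i \<in> {1..n}" "j \<in> {1..n}"
  shows "x \<in> Peirce_component R (e i) (e j) \<longleftrightarrow>
    x \<in> carrier R \<and> e i \<otimes> x = x \<and> x \<otimes> e j = x"
  using assms by (intro mem_Peirce_component_iff) auto

lemma carrier_P_iff:
  "A \<in> carrier P \<longleftrightarrow> A \<in> extensional ({1..n} \<times> {1..n}) \<and>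
    (\<forall>i\<in>{1..n}. \<forall>j\<in>{1..n}. A (i, j) \<in> carrier R \<and> e i \<otimes> A (i, j) = A (i, j) \<and>
      A (i, j) \<otimes> e j = A (i, j))"
  by (auto simp: Peirce_ring_def PiE_iff mem_component_iff)

lemma entry:
  assumes "A \<in> carrier P" "i \<in> {1..n}" "j \<in> {1..n}"
  shows "A (i, j) \<in> carrier R" "e i \<otimes> A (i, j) = A (i, j)" "A (i, j) \<otimes> e j = A (i, j)"
  using assms by (auto simp: carrier_P_iff)

lemma arrays_eqI:
  assumes "A \<in> carrier P" "B \<in> carrier P"
    and "\<And>i j. i \<in> {1..n} \<Longrightarrow> j \<in> {1..n} \<Longrightarrow> A (i, j) = B (i, j)"
  shows "A = B"
  using assms by (intro extensionalityI[of A "{1..n} \<times> {1..n}"]) (auto simp: carrier_P_iff)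

lemma P_mult: "i \<in> {1..n} \<Longrightarrow> j \<in> {1..n} \<Longrightarrow>
    (A \<otimes>\<^bsub>P\<^esub> B) (i, j) = (\<Oplus>k\<in>{1..n}. A (i, k) \<otimes> B (k, j))"
  and P_add: "i \<in> {1..n} \<Longrightarrow> j \<in> {1..n} \<Longrightarrow> (A \<oplus>\<^bsub>P\<^esub> B) (i, j) = A (i, j) \<oplus> B (i, j)"
  and P_one: "i \<in> {1..n} \<Longrightarrow> j \<in> {1..n} \<Longrightarrow> \<one>\<^bsub>P\<^esub> (i, j) = (if i = j then e i else \<zero>)"
  and P_zero: "i \<in> {1..n} \<Longrightarrow> j \<in> {1..n} \<Longrightarrow> \<zero>\<^bsub>P\<^esub> (i, j) = \<zero>"
  by (simp_all add: Peirce_ring_def)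

lemma P_extensional:
  "A \<otimes>\<^bsub>P\<^esub> B \<in> extensional ({1..n} \<times> {1..n})" "A \<oplus>\<^bsub>P\<^esub> B \<in> extensional ({1..n} \<times> {1..n})"
  "\<one>\<^bsub>P\<^esub> \<in> extensional ({1..n} \<times> {1..n})" "\<zero>\<^bsub>P\<^esub> \<in> extensional ({1..n} \<times> {1..n})"
  by (simp_all add: Peirce_ring_def)

definition Peirce_array :: "'a \<Rightarrow> nat \<times> nat \<Rightarrow> 'a"
  where "Peirce_array r = (\<lambda>(i, j)\<in>{1..n} \<times> {1..n}. e i \<otimes> r \<otimes> e j)"

lemma Peirce_array_entry:
  "i \<in> {1..n} \<Longrightarrow> j \<in> {1..n} \<Longrightarrow> Peirce_array r (i, j) = e i \<otimes> r \<otimes> e j"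
  by (simp add: Peirce_array_def)

lemma Peirce_array_extensional: "Peirce_array r \<in> extensional ({1..n} \<times> {1..n})"
  by (simp add: Peirce_array_def)

lemma Peirce_array_closed:
  assumes "r \<in> carrier R"
  shows "Peirce_array r \<in> carrier P"
proof -
  have "e i \<otimes> r \<otimes> e j \<in> Peirce_component R (e i) (e j)" for i j
    using assms unfolding Peirce_component_def by blast
  then show ?thesis by (auto simp: Peirce_ring_def Peirce_array_def)
qed

text \<open>This is what makes the multiplication of \<open>R\<close> the row-column multiplication of arrays.\<close>

lemma mult_eq_sum_through_idempotents:
  assumes "x \<in> carrier R" "y \<in> carrier R"
  shows "x \<otimes> y = (\<Oplus>k\<in>{1..n}. (x \<otimes> e k) \<otimes> (e k \<otimes> y))"
proof -
  have "x \<otimes> y = x \<otimes> (\<Oplus>k\<in>{1..n}. e k) \<otimes> y" using assms by (simp add: sum_idem del: One_nat_def)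
  also have "\<dots> = (\<Oplus>k\<in>{1..n}. x \<otimes> e k \<otimes> y)"
    using assms by (simp add: finsum_rdistr finsum_ldistr Pi_def)
  also have "\<dots> = (\<Oplus>k\<in>{1..n}. (x \<otimes> e k) \<otimes> (e k \<otimes> y))"
  proof (rule finsum_cong')
    fix k assume k: "k \<in> {1..n}"
    have "(x \<otimes> e k) \<otimes> (e k \<otimes> y) = x \<otimes> (e k \<otimes> e k) \<otimes> y"
      using assms k by (simp only: m_assoc m_closed idem_closed)
    then show "x \<otimes> e k \<otimes> y = (x \<otimes> e k) \<otimes> (e k \<otimes> y)" using k by simp
  qed (use assms in auto)
  finally show ?thesis .
qed

lemma eq_if_Peirce_array_eq:
  assumes r: "r \<in> carrier R" and s: "s \<in> carrier R" and eq: "Peirce_array r = Peirce_array s"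
  shows "r = s"
proof -
  have row: "x = (\<Oplus>j\<in>{1..n}. x \<otimes> e j)" and col: "x = (\<Oplus>i\<in>{1..n}. e i \<otimes> x)"
    if "x \<in> carrier R" for x
    using that finsum_rdistr[of "{1..n}" x e] finsum_ldistr[of "{1..n}" x e]
    by (simp_all add: sum_idem Pi_def del: One_nat_def)
  have "e i \<otimes> r = e i \<otimes> s" if i: "i \<in> {1..n}" for i
  proof -
    have "e i \<otimes> r \<otimes> e j = e i \<otimes> s \<otimes> e j" if "j \<in> {1..n}" for j
      using i that fun_cong[OF eq, of "(i, j)"] by (simp add: Peirce_array_entry)
    then have "(\<Oplus>j\<in>{1..n}. e i \<otimes> r \<otimes> e j) = (\<Oplus>j\<in>{1..n}. e i \<otimes> s \<otimes> e j)"
      using i s by (intro finsum_cong') auto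
    then show ?thesis using row[of "e i \<otimes> r"] row[of "e i \<otimes> s"] i r s by simp
  qed
  then have "(\<Oplus>i\<in>{1..n}. e i \<otimes> r) = (\<Oplus>i\<in>{1..n}. e i \<otimes> s)"
    using s by (intro finsum_cong') auto
  then show ?thesis using col[OF r] col[OF s] by simp
qed

text \<open>The preimage of an array is the sum of all its entries: multiplying that sum by \<open>e\<^sub>i\<close> on
  the left and by \<open>e\<^sub>j\<close> on the right leaves the \<open>(i, j)\<close>-entry by orthogonality.\<close>

lemma Peirce_array_surj:
  assumes A: "A \<in> carrier P"
  shows "\<exists>r\<in>carrier R. Peirce_array r = A"
proof
  let ?row = "\<lambda>k. \<Oplus>l\<in>{1..n}. A (k, l)"
  let ?r = "\<Oplus>k\<in>{1..n}. ?row k"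
  note a = entry[OF A]
  have row: "?row k \<in> carrier R" if "k \<in> {1..n}" for k
    using that a(1) by (intro finsum_closed) auto
  show r: "?r \<in> carrier R" using row by (intro finsum_closed) auto
  have left: "e i \<otimes> A (k, l) = \<zero>"
    if "i \<in> {1..n}" "k \<in> {1..n}" "l \<in> {1..n}" "k \<noteq> i" for i k l
  proof -
    have "e i \<otimes> A (k, l) = e i \<otimes> e k \<otimes> A (k, l)" using that a by (simp add: m_assoc)
    then show ?thesis using that a(1) by (simp add: orthogonal)
  qed
  have right: "A (k, l) \<otimes> e j = \<zero>"
    if "j \<in> {1..n}" "k \<in> {1..n}" "l \<in> {1..n}" "l \<noteq> j" for j k l
  proof -
    have "A (k, l) \<otimes> e j = A (k, l) \<otimes> (e l \<otimes> e j)"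
      using that a by (simp flip: m_assoc)
    then show ?thesis using that a(1) by (simp add: orthogonal)
  qed
  have "e i \<otimes> ?r \<otimes> e j = A (i, j)" if ij: "i \<in> {1..n}" "j \<in> {1..n}" for i j
  proof -
    have "e i \<otimes> ?row k = (if k = i then ?row i else \<zero>)" if k: "k \<in> {1..n}" for k
    proof -
      have "e i \<otimes> ?row k = (\<Oplus>l\<in>{1..n}. e i \<otimes> A (k, l))"
        using ij k a(1) by (intro finsum_rdistr) auto
      also have "\<dots> = (\<Oplus>l\<in>{1..n}. if k = i then A (i, l) else \<zero>)"
        using ij k a left by (intro finsum_cong') auto
      finally show ?thesis by simp
    qed
    then have "e i \<otimes> ?r = (\<Oplus>k\<in>{1..n}. if k = i then ?row i else \<zero>)"
      using ij row by (subst finsum_rdistr) (auto intro!: finsum_cong')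
    also have "\<dots> = ?row i"
      using ij row by (subst finsum_eq_single_term[of _ i]) auto
    finally have "e i \<otimes> ?r \<otimes> e j = ?row i \<otimes> e j" by simp
    also have "\<dots> = (\<Oplus>l\<in>{1..n}. A (i, l) \<otimes> e j)"
      using ij a(1) by (intro finsum_ldistr) auto
    also have "\<dots> = A (i, j)"
      using ij a right by (subst finsum_eq_single_term[of _ j]) auto
    finally show ?thesis .
  qed
  then show "Peirce_array ?r = A"
    using r A by (intro arrays_eqI) (auto simp: Peirce_array_entry Peirce_array_closed)
qed

lemma Peirce_array_iso: "Peirce_array \<in> ring_iso R P"
proof (rule ring_iso_memI)
  fix r s assume rs: "r \<in> carrier R" "s \<in> carrier R"
  show "Peirce_array (r \<otimes> s) = Peirce_array r \<otimes>\<^bsub>P\<^esub> Peirce_array s"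
  proof (rule extensionalityI[OF Peirce_array_extensional P_extensional(1)], clarify)
    fix i j assume ij: "i \<in> {1..n}" "j \<in> {1..n}"
    have "e i \<otimes> (r \<otimes> s) \<otimes> e j = (e i \<otimes> r) \<otimes> (s \<otimes> e j)"
      using ij rs by (simp add: m_assoc)
    also have "\<dots> = (\<Oplus>k\<in>{1..n}. (e i \<otimes> r \<otimes> e k) \<otimes> (e k \<otimes> (s \<otimes> e j)))"
      using ij rs by (intro mult_eq_sum_through_idempotents) auto
    also have "\<dots> = (\<Oplus>k\<in>{1..n}. Peirce_array r (i, k) \<otimes> Peirce_array s (k, j))"
      using ij rs by (intro finsum_cong') (auto simp: Peirce_array_entry m_assoc)
    finally show "Peirce_array (r \<otimes> s) (i, j) = (Peirce_array r \<otimes>\<^bsub>P\<^esub> Peirce_array s) (i, j)"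
      using ij by (simp add: Peirce_array_entry P_mult)
  qed
  show "Peirce_array (r \<oplus> s) = Peirce_array r \<oplus>\<^bsub>P\<^esub> Peirce_array s"
    using rs by (intro extensionalityI[OF Peirce_array_extensional P_extensional(2)])
      (auto simp: Peirce_array_entry P_add l_distr r_distr)
next
  show "Peirce_array \<one> = \<one>\<^bsub>P\<^esub>"
    by (intro extensionalityI[OF Peirce_array_extensional P_extensional(3)])
      (auto simp: Peirce_array_entry P_one orthogonal)
next
  show "bij_betw Peirce_array (carrier R) (carrier P)"
    unfolding bij_betw_def inj_on_def
    using eq_if_Peirce_array_eq Peirce_array_surj Peirce_array_closed by blast
qed (rule Peirce_array_closed)

lemma P_ring: "ring P"
proof -
  have "Peirce_array \<zero> = \<zero>\<^bsub>P\<^esub>"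
    by (intro extensionalityI[OF Peirce_array_extensional P_extensional(4)])
      (auto simp: Peirce_array_entry P_zero)
  then show ?thesis using ring_iso_imp_img_ring[OF Peirce_array_iso] by simp
qed

section \<open>Peirce triviality in terms of paths\<close>

lemma complement_idem:
  assumes "i \<in> {1..n}" "j \<in> {1..n}" "i \<noteq> j"
  shows "(\<one> \<ominus> e i) \<otimes> e j = e j" "e j \<otimes> (\<one> \<ominus> e i) = e j"
  using assms by (simp_all add: minus_eq l_distr r_distr l_minus r_minus orthogonal)

lemma inner_trivial_no_return:
  assumes triv: "inner_Peirce_trivial R (e i)"
    and ij: "i \<in> {1..n}" "j \<in> {1..n}" "i \<noteq> j"
    and r: "r \<in> carrier R" and s: "s \<in> carrier R"
  shows "e i \<otimes> r \<otimes> e j \<otimes> s \<otimes> e i = \<zero>"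
proof -
  have "e i \<otimes> r \<otimes> (\<one> \<ominus> e i) \<otimes> (e j \<otimes> s) \<otimes> e i \<in> {\<zero>}"
    unfolding triv[unfolded inner_Peirce_trivial_def, symmetric]
    using r s ij by (intro ideal_prod.prod) auto
  moreover have "e i \<otimes> r \<otimes> (\<one> \<ominus> e i) \<otimes> (e j \<otimes> s) \<otimes> e i
      = e i \<otimes> r \<otimes> ((\<one> \<ominus> e i) \<otimes> e j) \<otimes> s \<otimes> e i"
    using r s ij by (simp only: m_assoc m_closed minus_closed one_closed idem_closed)
  ultimately show ?thesis using ij by (simp add: complement_idem)
qed

lemma outer_trivial_no_passage:
  assumes triv: "outer_Peirce_trivial R (e k)"
    and k: "k \<in> {1..n}" and ij: "i \<in> {1..n}" "j \<in> {1..n}" "k \<noteq> i" "k \<noteq> j"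
    and r: "r \<in> carrier R" and s: "s \<in> carrier R"
  shows "e i \<otimes> r \<otimes> e k \<otimes> s \<otimes> e j = \<zero>"
proof -
  have "(\<one> \<ominus> e k) \<otimes> r \<otimes> e k \<otimes> s \<otimes> (\<one> \<ominus> e k) \<in> {\<zero>}"
    unfolding triv[unfolded outer_Peirce_trivial_def, symmetric]
    using r s k by (intro ideal_prod.prod) auto
  then have "e i \<otimes> ((\<one> \<ominus> e k) \<otimes> r \<otimes> e k \<otimes> s \<otimes> (\<one> \<ominus> e k)) \<otimes> e j = \<zero>"
    using k ij by simp
  moreover have "e i \<otimes> ((\<one> \<ominus> e k) \<otimes> r \<otimes> e k \<otimes> s \<otimes> (\<one> \<ominus> e k)) \<otimes> e j
      = (e i \<otimes> (\<one> \<ominus> e k)) \<otimes> r \<otimes> e k \<otimes> s \<otimes> ((\<one> \<ominus> e k) \<otimes> e j)"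
    using r s k ij by (simp only: m_assoc m_closed minus_closed one_closed idem_closed)
  ultimately show ?thesis using k ij by (simp add: complement_idem)
qed

section \<open>Powers of the arrays with zero diagonal\<close>

abbreviation X where "X \<equiv> zero_diagonal R e n"

lemma X_D: "A \<in> X \<Longrightarrow> A \<in> carrier P" "A \<in> X \<Longrightarrow> i \<in> {1..n} \<Longrightarrow> A (i, i) = \<zero>"
  by (auto simp: zero_diagonal_def)

lemma X_power_closed: "A \<in> subset_power P X k \<Longrightarrow> A \<in> carrier P"
proof (induction k arbitrary: A)
  case (Suc k)
  interpret P: ring P by (rule P_ring)
  show ?case
  proof (cases k)
    case 0
    then show ?thesis using Suc.prems X_D(1) by simp
  next
    case (Suc m)
    then have "A \<in> subset_power P X k \<cdot>\<^bsub>P\<^esub> X" using Suc.prems by simp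
    then show ?thesis by (induction rule: ideal_prod.induct) (use Suc.IH X_D(1) in auto)
  qed
qed simp

lemma zero_mem_X_power: "\<zero>\<^bsub>P\<^esub> \<in> subset_power P X k"
proof (induction k)
  case 0
  then show ?case using ring.ring_simprules(2)[OF P_ring] by simp
next
  case (Suc k)
  interpret P: ring P by (rule P_ring)
  have zero: "\<zero>\<^bsub>P\<^esub> \<in> X" by (simp add: zero_diagonal_def P_zero)
  show ?case
  proof (cases k)
    case 0
    then show ?thesis using zero by simp
  next
    case (Suc m)
    then show ?thesis
      using ideal_prod.prod[of "\<zero>\<^bsub>P\<^esub>" "subset_power P X k" "\<zero>\<^bsub>P\<^esub>" X P] Suc.IH zero by simp
  qed
qed

text \<open>One step of a path, from \<open>l\<close> to the start \<open>j\<close> of a tail \<open>v\<close>. If \<open>l = j\<close> the factor is a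
  diagonal entry, and if \<open>l\<close> is used up the tail kills it. Otherwise the longer tail inherits the
  used indices of \<open>v\<close>, and \<open>j\<close> joins them because a return to \<open>j\<close> contributes zero.\<close>

lemma prepend_zero_diagonal_entry:
  assumes triv: "\<And>i. i \<in> {1..n} \<Longrightarrow> inner_Peirce_trivial R (e i)"
    and B: "B \<in> X" and l: "l \<in> {1..n}" and j: "j \<in> {1..n}" and S: "S \<subseteq> {1..n}"
    and v: "v \<in> carrier R" "e j \<otimes> v = v"
    and used: "\<And>s x. s \<in> S \<Longrightarrow> x \<in> carrier R \<Longrightarrow> e s \<otimes> x \<otimes> v = \<zero>"
  shows "B (l, j) \<otimes> v = \<zero> \<or> l \<notin> insert j S \<and>
    (\<forall>s\<in>insert j S. \<forall>x\<in>carrier R. e s \<otimes> x \<otimes> (B (l, j) \<otimes> v) = \<zero>)"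
proof (cases "l \<in> insert j S")
  case True
  note b = entry[OF X_D(1)[OF B] l j]
  show ?thesis
  proof (cases "l = j")
    case True
    then show ?thesis using X_D(2)[OF B j] v by simp
  next
    case False
    with True have "e l \<otimes> B (l, j) \<otimes> v = \<zero>" using used b(1) by blast
    then show ?thesis using b by simp
  qed
next
  case False
  note b = entry[OF X_D(1)[OF B] l j]
  have "e s \<otimes> x \<otimes> (B (l, j) \<otimes> v) = \<zero>" if s: "s \<in> insert j S" and x: "x \<in> carrier R" for s x
  proof (cases "s = j")
    case True
    \<comment> \<open>The path would go from \<open>j\<close> to \<open>l\<close> and back to \<open>j\<close>.\<close>
    have "e j \<otimes> x \<otimes> (B (l, j) \<otimes> v) = e j \<otimes> x \<otimes> ((e l \<otimes> B (l, j)) \<otimes> (e j \<otimes> v))"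
      using b v by simp
    also have "\<dots> = e j \<otimes> x \<otimes> e l \<otimes> B (l, j) \<otimes> e j \<otimes> v"
      using b(1) v(1) x j l by (simp only: m_assoc m_closed idem_closed)
    also have "\<dots> = \<zero>"
      using inner_trivial_no_return[OF triv[OF j] j l _ x b(1)] False v by simp
    finally show ?thesis using True by simp
  next
    case False
    then have "s \<in> S" using s by simp
    then have "e s \<otimes> (x \<otimes> B (l, j)) \<otimes> v = \<zero>" using used x b(1) by simp
    moreover have "e s \<in> carrier R" using \<open>s \<in> S\<close> S by auto
    ultimately show ?thesis using b(1) x v(1) by (simp add: m_assoc)
  qed
  then show ?thesis using False by blast
qed

text \<open>The reason is a count: the bound on \<open>S\<close> leaves at most \<open>k + 1\<close> unused indices for the
  \<open>k + 2\<close> distinct vertices of a path with \<open>k + 1\<close> steps that ends at \<open>j\<close>. The induction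
  takes off the rightmost factor, as powers are built by multiplication on the right; absorbing
  that factor into \<open>v\<close> puts \<open>j\<close> into \<open>S\<close>, so that the bound is kept.\<close>

lemma zero_diagonal_power_annihilates:
  assumes triv: "\<And>i. i \<in> {1..n} \<Longrightarrow> inner_Peirce_trivial R (e i)"
    and "A \<in> subset_power P X (Suc k)"
    and "i \<in> {1..n}" "j \<in> {1..n}" "S \<subseteq> {1..n}" "j \<notin> S" "n \<le> card S + Suc k"
    and "v \<in> carrier R" "e j \<otimes> v = v"
    and "\<And>s x. s \<in> S \<Longrightarrow> x \<in> carrier R \<Longrightarrow> e s \<otimes> x \<otimes> v = \<zero>"
  shows "A (i, j) \<otimes> v = \<zero>"
  using assms(2-)
proof (induction k arbitrary: A i j S v)
  case 0
  have fin: "finite S" using 0(4) finite_subset by blast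
  have "insert j S = {1..n}"
    using 0(3-6) fin by (intro card_seteq) auto
  then have "i \<in> insert j S" using 0(2) by simp
  with prepend_zero_diagonal_entry[OF triv _ 0(2,3,4,7,8,9)] 0(1)
  show ?case by (metis subset_power.simps(2))
next
  case (Suc k)
  have "A \<in> subset_power P X (Suc k) \<cdot>\<^bsub>P\<^esub> X" using Suc.prems(1) by simp
  then have "A (i, j) \<otimes> v = \<zero> \<and> A \<in> carrier P"
  proof (induction rule: ideal_prod.induct)
    case (prod A B)
    interpret P: ring P by (rule P_ring)
    have AB: "A \<in> carrier P" "B \<in> carrier P"
      using prod X_power_closed X_D by blast+
    have "A (i, l) \<otimes> (B (l, j) \<otimes> v) = \<zero>" if l: "l \<in> {1..n}" for l
    proof (cases "B (l, j) \<otimes> v = \<zero>")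
      case True
      then show ?thesis using entry[OF AB(1) \<open>i \<in> {1..n}\<close> l] by simp
    next
      case False
      note step = prepend_zero_diagonal_entry[OF triv prod(2) l Suc.prems(3,4,7,8,9)]
      have b: "B (l, j) \<in> carrier R" "e l \<otimes> B (l, j) = B (l, j)"
        using entry[OF AB(2) l \<open>j \<in> {1..n}\<close>] by auto
      have fin: "finite S" using Suc.prems(4) finite_subset by blast
      show ?thesis
      proof (rule Suc.IH[OF prod(1) Suc.prems(2) l, of "insert j S"])
        show "insert j S \<subseteq> {1..n}" using Suc.prems(3,4) by blast
        show "n \<le> card (insert j S) + Suc k" using Suc.prems(5,6) fin by simp
        show "B (l, j) \<otimes> v \<in> carrier R" using b Suc.prems(7) by simp
        show "e l \<otimes> (B (l, j) \<otimes> v) = B (l, j) \<otimes> v"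
          using b Suc.prems(7) l by (simp flip: m_assoc)
        show "l \<notin> insert j S" using step False by blast
        show "e s \<otimes> x \<otimes> (B (l, j) \<otimes> v) = \<zero>" if "s \<in> insert j S" "x \<in> carrier R" for s x
          using step False that by blast
      qed
    qed
    moreover have "(A \<otimes>\<^bsub>P\<^esub> B) (i, j) \<otimes> v = (\<Oplus>l\<in>{1..n}. A (i, l) \<otimes> (B (l, j) \<otimes> v))"
    proof -
      have "(A \<otimes>\<^bsub>P\<^esub> B) (i, j) \<otimes> v = (\<Oplus>l\<in>{1..n}. A (i, l) \<otimes> B (l, j) \<otimes> v)"
        using Suc.prems(2,3,7) entry(1)[OF AB(1)] entry(1)[OF AB(2)]
        by (simp add: P_mult finsum_ldistr Pi_def)
      also have "\<dots> = (\<Oplus>l\<in>{1..n}. A (i, l) \<otimes> (B (l, j) \<otimes> v))"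
        using Suc.prems(2,3,7) entry(1)[OF AB(1)] entry(1)[OF AB(2)]
        by (intro finsum_cong') (auto simp: m_assoc)
      finally show ?thesis .
    qed
    moreover have "(\<Oplus>l\<in>{1..n}. A (i, l) \<otimes> (B (l, j) \<otimes> v)) = \<zero>"
      using calculation(1) by (rule add.finprod_one_eqI)
    ultimately show ?case using AB by simp
  next
    case (sum A B)
    interpret P: ring P by (rule P_ring)
    show ?case
      using sum Suc.prems(2,3,7) entry(1)[of A i j] entry(1)[of B i j]
      by (simp add: P_add l_distr)
  qed
  then show ?case ..
qed

theorem X_power_n_eq_zero:
  assumes triv: "\<And>i. i \<in> {1..n} \<Longrightarrow> inner_Peirce_trivial R (e i)" and n: "n \<ge> 1"
  shows "subset_power P X n = {\<zero>\<^bsub>P\<^esub>}"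
proof -
  interpret P: ring P by (rule P_ring)
  obtain k where k: "n = Suc k" using n by (cases n) auto
  have "A = \<zero>\<^bsub>P\<^esub>" if A: "A \<in> subset_power P X n" for A
  proof (rule arrays_eqI[OF X_power_closed[OF A] P.zero_closed])
    fix i j assume ij: "i \<in> {1..n}" "j \<in> {1..n}"
    \<comment> \<open>Start with the empty tail at \<open>j\<close>, for which no index is used up.\<close>
    have "A (i, j) \<otimes> e j = \<zero>"
      using zero_diagonal_power_annihilates[OF triv _ ij, of A k "{}" "e j"] A ij k by simp
    then show "A (i, j) = \<zero>\<^bsub>P\<^esub> (i, j)"
      using entry(3)[OF X_power_closed[OF A] ij] ij by (simp add: P_zero)
  qed
  then show ?thesis using zero_mem_X_power by blast
qed

theorem X_square_eq_zero:
  assumes triv: "\<And>k. k \<in> {1..n} \<Longrightarrow> outer_Peirce_trivial R (e k)"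
  shows "subset_power P X 2 = {\<zero>\<^bsub>P\<^esub>}"
proof -
  interpret P: ring P by (rule P_ring)
  have two: "subset_power P X 2 = X \<cdot>\<^bsub>P\<^esub> X" by (simp add: numeral_2_eq_2)
  have prod_zero: "A \<otimes>\<^bsub>P\<^esub> B = \<zero>\<^bsub>P\<^esub>" if AB: "A \<in> X" "B \<in> X" for A B
  proof (rule arrays_eqI)
    fix i j assume ij: "i \<in> {1..n}" "j \<in> {1..n}"
    have "A (i, k) \<otimes> B (k, j) = \<zero>" if k: "k \<in> {1..n}" for k
    proof -
      note a = entry[OF X_D(1)[OF AB(1)] ij(1) k] and b = entry[OF X_D(1)[OF AB(2)] k ij(2)]
      show ?thesis
      proof (cases "k = i \<or> k = j")
        case True
        then show ?thesis using X_D(2)[OF AB(1) k] X_D(2)[OF AB(2) k] a b by auto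
      next
        case False
        have "A (i, k) \<otimes> B (k, j) = (e i \<otimes> A (i, k) \<otimes> e k) \<otimes> (B (k, j) \<otimes> e j)"
          using a b by simp
        also have "\<dots> = e i \<otimes> A (i, k) \<otimes> e k \<otimes> B (k, j) \<otimes> e j"
          using a(1) b(1) ij k by (simp add: m_assoc)
        also have "\<dots> = \<zero>"
          using False a(1) b(1) outer_trivial_no_passage[OF triv[OF k] k ij] by blast
        finally show ?thesis .
      qed
    qed
    then have "(\<Oplus>k\<in>{1..n}. A (i, k) \<otimes> B (k, j)) = \<zero>"
      by (rule add.finprod_one_eqI)
    then show "(A \<otimes>\<^bsub>P\<^esub> B) (i, j) = \<zero>\<^bsub>P\<^esub> (i, j)"
      using ij by (simp add: P_mult P_zero)
  qed (use AB X_D in auto)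
  have "A = \<zero>\<^bsub>P\<^esub>" if "A \<in> X \<cdot>\<^bsub>P\<^esub> X" for A
    using that by (induction rule: ideal_prod.induct) (simp_all add: prod_zero)
  then show ?thesis using zero_mem_X_power[of 2] two by blast
qed

section \<open>The diagonal homomorphism\<close>

abbreviation diagonal_ring where
  "diagonal_ring \<equiv> RDirProd_list (map (\<lambda>i. corner_ring R (e i)) [1..<Suc n])"

abbreviation diagonal :: "(nat \<times> nat \<Rightarrow> 'a) \<Rightarrow> 'a list" where
  "diagonal A \<equiv> map (\<lambda>i. A (i, i)) [1..<Suc n]"

lemma diagonal_entry_hom:
  assumes triv: "inner_Peirce_trivial R (e i)" and i: "i \<in> {1..n}"
  shows "(\<lambda>A. A (i, i)) \<in> ring_hom P (corner_ring R (e i))"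
proof (rule ring_hom_memI)
  fix A B assume AB: "A \<in> carrier P" "B \<in> carrier P"
  show "A (i, i) \<in> carrier (corner_ring R (e i))"
    using entry[OF AB(1) i i] i by (simp add: corner_ring_def mem_component_iff)
  show "(A \<oplus>\<^bsub>P\<^esub> B) (i, i) = A (i, i) \<oplus>\<^bsub>corner_ring R (e i)\<^esub> B (i, i)"
    using i by (simp add: P_add corner_ring_def)
  \<comment> \<open>Every other path from \<open>i\<close> to \<open>i\<close> leaves \<open>i\<close> and returns.\<close>
  have "A (i, k) \<otimes> B (k, i) = \<zero>" if k: "k \<in> {1..n}" "k \<noteq> i" for k
  proof -
    note a = entry[OF AB(1) i k(1)] and b = entry[OF AB(2) k(1) i]
    have "A (i, k) \<otimes> B (k, i) = (e i \<otimes> A (i, k) \<otimes> e k) \<otimes> (B (k, i) \<otimes> e i)"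
      using a b by simp
    also have "\<dots> = e i \<otimes> A (i, k) \<otimes> e k \<otimes> B (k, i) \<otimes> e i"
      using a(1) b(1) i k by (simp add: m_assoc)
    also have "\<dots> = \<zero>"
      using inner_trivial_no_return[OF triv i k(1)] k(2) a(1) b(1) by blast
    finally show ?thesis .
  qed
  then have "(\<Oplus>k\<in>{1..n}. A (i, k) \<otimes> B (k, i)) = A (i, i) \<otimes> B (i, i)"
    using i entry(1)[OF AB(1) i i] entry(1)[OF AB(2) i i]
    by (subst finsum_eq_single_term[of _ i]) auto
  then show "(A \<otimes>\<^bsub>P\<^esub> B) (i, i) = A (i, i) \<otimes>\<^bsub>corner_ring R (e i)\<^esub> B (i, i)"
    using i by (simp add: P_mult corner_ring_def)
next
  show "\<one>\<^bsub>P\<^esub> (i, i) = \<one>\<^bsub>corner_ring R (e i)\<^esub>"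
    using i by (simp add: P_one corner_ring_def)
qed

theorem diagonal_hom:
  assumes triv: "\<And>i. i \<in> {1..n} \<Longrightarrow> inner_Peirce_trivial R (e i)"
  shows "ring_hom_ring P diagonal_ring diagonal"
proof (rule ring_hom_ringI2[OF P_ring])
  show "ring diagonal_ring"
    by (rule RDirProd_list_is_ring) (auto intro!: corner_ring_is_ring simp del: upt_Suc)
  show "diagonal \<in> ring_hom P diagonal_ring"
    by (rule ring_hom_RDirProd_list) (use triv in \<open>auto intro: diagonal_entry_hom\<close>)
qed

lemma diagonal_surj:
  assumes "diagonal ` carrier P \<subseteq> carrier diagonal_ring"
  shows "diagonal ` carrier P = carrier diagonal_ring"
proof (rule subset_antisym[OF assms], rule subsetI)
  fix as assume as: "as \<in> carrier diagonal_ring"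
  have len: "length as = n" using RDirProd_list_carrier_mem(1)[OF as] by simp
  \<comment> \<open>List positions start at 0, indices at 1.\<close>
  have nth: "as ! (i - 1) \<in> Peirce_component R (e i) (e i)" if "i \<in> {1..n}" for i
  proof -
    have "i - 1 < n" "Suc (i - 1) = i" using that by auto
    then show ?thesis
      using RDirProd_list_carrier_mem(2)[OF as, of "i - 1"]
      by (simp add: corner_ring_def del: upt_Suc)
  qed
  define A where "A = (\<lambda>(i, j)\<in>{1..n} \<times> {1..n}. if i = j then as ! (i - 1) else \<zero>)"
  have "\<zero> \<in> Peirce_component R (e i) (e j)" if "i \<in> {1..n}" "j \<in> {1..n}" for i j
    using mem_component_iff[OF that] that by simp
  with nth have "A \<in> carrier P"
    by (simp add: A_def Peirce_ring_def PiE_iff)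
  moreover have "diagonal A = as"
  proof (rule nth_equalityI)
    fix k assume "k < length (diagonal A)"
    then have "diagonal A ! k = A (Suc k, Suc k)" "k < n" by (simp_all del: upt_Suc)
    then show "diagonal A ! k = as ! k" by (simp add: A_def)
  qed (simp add: len del: upt_Suc)
  ultimately show "as \<in> diagonal ` carrier P" by blast
qed

lemma diagonal_kernel: "a_kernel P diagonal_ring diagonal = X"
  unfolding a_kernel_def' zero_RDirProd_list_map zero_diagonal_def
  by (auto simp: corner_ring_def simp del: upt_Suc)

end

theorem proposition2p4:
  fixes R (structure) and e :: "nat \<Rightarrow> 'a" and n :: nat
    and X :: "(nat \<times> nat \<Rightarrow> 'a) set"
  assumes "ring R" and "n \<ge> 1"
    and "complete_orthogonal_idempotents R e n"
    and X: "X = zero_diagonal R e n"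
  shows "(e ` {1..n} \<subseteq> inner_Peirce_trivial_idempotents R \<longrightarrow>
            subset_power (Peirce_ring R e n) X n = {\<zero>\<^bsub>Peirce_ring R e n\<^esub>} \<and>
            (let S = RDirProd_list (map (\<lambda>i. corner_ring R (e i)) [1..<Suc n]) in
              \<exists>h. ring_hom_ring (Peirce_ring R e n) S h \<and>
                  h ` carrier (Peirce_ring R e n) = carrier S \<and>
                  a_kernel (Peirce_ring R e n) S h = X)) \<and>
         (e ` {1..n} \<subseteq> Peirce_trivial_idempotents R \<longrightarrow>
            subset_power (Peirce_ring R e n) X 2 = {\<zero>\<^bsub>Peirce_ring R e n\<^esub>})"
proof -
  interpret complete_idempotents R e n
    using assms(1,3) by (simp add: complete_idempotents_def complete_idempotents_axioms_def)
  show ?thesis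
    unfolding X Let_def
  proof (intro conjI impI)
    assume "e ` {1..n} \<subseteq> inner_Peirce_trivial_idempotents R"
    then have triv: "inner_Peirce_trivial R (e i)" if "i \<in> {1..n}" for i
      using that unfolding inner_Peirce_trivial_idempotents_def by blast
    show "subset_power P (zero_diagonal R e n) n = {\<zero>\<^bsub>P\<^esub>}"
      using triv assms(2) by (rule X_power_n_eq_zero)
    interpret diagonal: ring_hom_ring P diagonal_ring diagonal
      using triv by (rule diagonal_hom)
    have "diagonal ` carrier P = carrier diagonal_ring"
      by (rule diagonal_surj) (use diagonal.homh in \<open>auto simp: ring_hom_def\<close>)
    then show "\<exists>h. ring_hom_ring P diagonal_ring h \<and> h ` carrier P = carrier diagonal_ring \<and>
        a_kernel P diagonal_ring h = zero_diagonal R e n"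
      using diagonal.is_ring_hom_ring diagonal_kernel by blast
  next
    assume "e ` {1..n} \<subseteq> Peirce_trivial_idempotents R"
    then have "outer_Peirce_trivial R (e k)" if "k \<in> {1..n}" for k
      using that unfolding Peirce_trivial_idempotents_def by blast
    then show "subset_power P (zero_diagonal R e n) 2 = {\<zero>\<^bsub>P\<^esub>}"
      by (rule X_square_eq_zero)
  qed
qed

end
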